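(* Let $k\ge 5$ and $n\ge 1$ be integers and let $N=n+k-4$. If the Diophantine equation $a(k-1)+b(k-2)=N$ has no solution in non-negative integers $(a,b)$, then $r(S_n,P_k)\le N$. In particular, when $n=(k-3)^2$, no such solution exists (and hence $r(S_n,P_k)\le N$ in that case).
   Context: All graphs are finite and simple. For graphs $H_1,H_2$, the Ramsey number $r(H_1,H_2)$ is the smallest positive integer $N$ such that every graph $\Gamma$ on $N$ vertices contains $H_1$ as a (not necessarily induced) subgraph or its complement $\overline{\Gamma}$ contains $H_2$ as a subgraph. $S_n$ is the star on $n$ vertices (one center adjacent to $n-1$ leaves) and $P_k$ is the path on $k$ vertices. *)

theory Defs
  imports "HOL-Library.Ramsey"
begin

text \<open>A graph is a pair of a vertex set and a set of edges, an edge being a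
  two-element set of vertices.\<close>

type_synonym 'a graph = "'a set \<times> 'a set set"

definition simple_graph :: "'a graph \<Rightarrow> bool" where
  "simple_graph G \<longleftrightarrow> finite (fst G) \<and> snd G \<subseteq> [fst G]\<^bsup>2\<^esup>"

definition complement :: "'a graph \<Rightarrow> 'a graph" where
  "complement G = (fst G, [fst G]\<^bsup>2\<^esup> - snd G)"

text \<open>\<open>G\<close> contains a copy of \<open>H\<close> as a (not necessarily induced) subgraph.\<close>

definition contains_copy :: "'a graph \<Rightarrow> 'b graph \<Rightarrow> bool" where
  "contains_copy G H \<longleftrightarrow>
    (\<exists>f. inj_on f (fst H) \<and> f ` fst H \<subseteq> fst G \<and> (\<forall>e\<in>snd H. f ` e \<in> snd G))"

definition ramsey_prop :: "'a graph \<Rightarrow> 'b graph \<Rightarrow> nat \<Rightarrow> bool" where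
  "ramsey_prop H1 H2 N \<longleftrightarrow>
    (\<forall>G :: nat graph. simple_graph G \<and> card (fst G) = N \<longrightarrow>
       contains_copy G H1 \<or> contains_copy (complement G) H2)"

text \<open>Restricting the host graphs to vertices in \<^typ>\<open>nat\<close> is harmless, as every finite graph is
  isomorphic to one of these. For simple graphs the minimum exists; see
  \<open>ramsey_number_works\<close> below.\<close>

definition ramsey_number :: "'a graph \<Rightarrow> 'b graph \<Rightarrow> nat" where
  "ramsey_number H1 H2 = (LEAST N. 0 < N \<and> ramsey_prop H1 H2 N)"

text \<open>The index counts vertices: the star has centre \<open>0\<close> and \<open>n - 1\<close> leaves, and
  the path has \<open>k - 1\<close> edges.\<close>

definition star_graph :: "nat \<Rightarrow> nat graph" where
  "star_graph n = ({..<n}, {{0, i} | i. 0 < i \<and> i < n})"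

definition path_graph :: "nat \<Rightarrow> nat graph" where
  "path_graph k = ({..<k}, {{i, Suc i} | i. Suc i < k})"

lemma simple_star_graph: "simple_graph (star_graph n)"
  by (auto simp: simple_graph_def star_graph_def)

lemma simple_path_graph: "simple_graph (path_graph k)"
  by (auto simp: simple_graph_def path_graph_def)

lemma contains_copy_complete:
  assumes H: "simple_graph H" and R: "finite R" "R \<subseteq> fst G" "card R = card (fst H)"
    and E: "[R]\<^bsup>2\<^esup> \<subseteq> snd G"
  shows "contains_copy G H"
proof -
  obtain f where f: "bij_betw f (fst H) R"
    using H R finite_same_card_bij[of "fst H" R] by (auto simp: simple_graph_def)
  then have inj: "inj_on f (fst H)" and im: "f ` fst H = R"
    by (auto simp: bij_betw_def)
  have "f ` e \<in> snd G" if "e \<in> snd H" for e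
  proof -
    have e: "e \<subseteq> fst H" "finite e" "card e = 2"
      using H that by (auto simp: simple_graph_def nsets_def)
    then have "card (f ` e) = 2"
      using card_image[OF inj_on_subset[OF inj e(1)]] by simp
    then have "f ` e \<in> [R]\<^bsup>2\<^esup>"
      using e im by (auto simp: nsets_def)
    then show ?thesis using E by blast
  qed
  then show ?thesis
    unfolding contains_copy_def using inj im R(2) by blast
qed

lemma ramsey_number_works:
  assumes H1: "simple_graph H1" and H2: "simple_graph H2"
  shows "0 < ramsey_number H1 H2 \<and> ramsey_prop H1 H2 (ramsey_number H1 H2)"
proof -
  obtain r where r: "r \<ge> 1" and ram: "\<And>(V :: nat set) E. finite V \<Longrightarrow> card V \<ge> r \<Longrightarrow>
      \<exists>R\<subseteq>V. card R = card (fst H1) \<and> clique R E \<or> card R = card (fst H2) \<and> indep R E"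
    using ramsey2[of "card (fst H1)" "card (fst H2)"] by metis
  have "ramsey_prop H1 H2 r"
    unfolding ramsey_prop_def
  proof (intro allI impI)
    fix G :: "nat graph"
    assume G: "simple_graph G \<and> card (fst G) = r"
    then have fin: "finite (fst G)" by (simp add: simple_graph_def)
    then obtain R where R: "R \<subseteq> fst G"
      and "card R = card (fst H1) \<and> clique R (snd G) \<or> card R = card (fst H2) \<and> indep R (snd G)"
      using ram[of "fst G" "snd G"] G by auto
    then consider "card R = card (fst H1)" "clique R (snd G)"
      | "card R = card (fst H2)" "indep R (snd G)" by blast
    then show "contains_copy G H1 \<or> contains_copy (complement G) H2"
    proof cases
      case 1
      have "[R]\<^bsup>2\<^esup> \<subseteq> snd G"
        using 1(2) by (auto simp: clique_def nsets_2_eq)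
      then show ?thesis
        using contains_copy_complete[OF H1] 1(1) R fin finite_subset by blast
    next
      case 2
      have "[R]\<^bsup>2\<^esup> \<subseteq> snd (complement G)"
        using 2(2) R nsets_mono[OF R, of 2] by (fastforce simp: indep_def complement_def elim!: nsets2_E)
      moreover have "R \<subseteq> fst (complement G)"
        using R by (simp add: complement_def)
      ultimately show ?thesis
        using contains_copy_complete[OF H2] 2(1) R fin finite_subset by blast
    qed
  qed
  then have "\<exists>N. 0 < N \<and> ramsey_prop H1 H2 N"
    using r by (intro exI[of _ r]) simp
  then show ?thesis
    unfolding ramsey_number_def by (rule LeastI_ex)
qed

end

theory Submission
  imports Defs
begin

text \<open>A graph \<open>\<Gamma>\<close> on \<open>N\<close> vertices without \<open>S\<^sub>n\<close> has maximum degree at most \<open>n - 2\<close>, so its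
  complement has minimum degree at least \<open>d = k - 3\<close>. Suppose the complement has no \<open>P\<^sub>k\<close>. A longest
  path has at least \<open>d + 1\<close> and at most \<open>d + 2 \<le> 2d\<close> vertices and contains all neighbours of both
  of its ends, so by Dirac's crossing argument its vertex set carries a spanning cycle. An edge
  leaving this set would give a longer path; the set can therefore be removed without affecting the
  other degrees, and by induction \<open>N\<close> is a sum of terms \<open>k - 2\<close> and \<open>k - 1\<close>. For
  \<open>n = (k - 3)\<^sup>2\<close>, \<open>N\<close> is the Frobenius number of \<open>k - 2\<close> and \<open>k - 1\<close>.\<close>

section \<open>Decomposing a graph without long paths\<close>

text \<open>Pigeonhole on the \<open>length p - 1 < 2 * d\<close> edges of the path: some edge has
  its right end adjacent to \<open>hd p\<close> and its left end adjacent to \<open>last p\<close>.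
  Exchanging this edge for the two chords closes the path into a cycle.\<close>

lemma spanning_cycle_of_path:
  assumes sym: "\<And>x y. E x y \<Longrightarrow> E y x" and irr: "\<And>x. \<not> E x x"
    and p: "p \<noteq> []" "distinct p" "successively E p" and len: "length p \<le> 2 * d"
    and hd: "card {w \<in> set p. E (hd p) w} \<ge> d" and last: "card {w \<in> set p. E (last p) w} \<ge> d"
  obtains c where "c \<noteq> []" "distinct c" "set c = set p" "successively E c" "E (last c) (hd c)"
proof -
  define m where "m = length p"
  \<comment> \<open>Both sets index edges of the path by the position of the left end, hence the
    shift by one in \<open>A\<close> only.\<close>
  define A where "A = {i. Suc i < m \<and> E (hd p) (p ! Suc i)}"
  define B where "B = {i. Suc i < m \<and> E (last p) (p ! i)}"
  have m: "m > 0" using p by (simp add: m_def)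
  have hd0: "hd p = p ! 0" and lastm: "last p = p ! (m - 1)"
    using p by (simp_all add: hd_conv_nth last_conv_nth m_def)
  have fin: "finite A" "finite B"
    by (auto simp: A_def B_def intro!: finite_subset[of _ "{..<m}"])
  have "{w \<in> set p. E (hd p) w} \<subseteq> (\<lambda>i. p ! Suc i) ` A"
  proof
    fix w assume "w \<in> {w \<in> set p. E (hd p) w}"
    then obtain j where j: "j < m" "w = p ! j" "E (hd p) (p ! j)"
      by (auto simp: in_set_conv_nth m_def)
    \<comment> \<open>The head is not its own neighbour, so the shift loses no neighbour.\<close>
    then have "j \<noteq> 0" using irr hd0 by metis
    then show "w \<in> (\<lambda>i. p ! Suc i) ` A"
      using j by (intro image_eqI[of _ _ "j - 1"]) (auto simp: A_def)
  qed
  then have cA: "card A \<ge> d"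
    using hd fin by (meson card_image_le card_mono finite_imageI order_trans)
  have "{w \<in> set p. E (last p) w} \<subseteq> (\<lambda>i. p ! i) ` B"
  proof
    fix w assume "w \<in> {w \<in> set p. E (last p) w}"
    then obtain j where j: "j < m" "w = p ! j" "E (last p) (p ! j)"
      by (auto simp: in_set_conv_nth m_def)
    then have "j \<noteq> m - 1" using irr lastm by metis
    then show "w \<in> (\<lambda>i. p ! i) ` B"
      using j by (intro image_eqI[of _ _ j]) (auto simp: B_def)
  qed
  then have cB: "card B \<ge> d"
    using last fin by (meson card_image_le card_mono finite_imageI order_trans)
  have "A \<inter> B \<noteq> {}"
  proof
    assume "A \<inter> B = {}"
    then have "card A + card B = card (A \<union> B)"
      using fin by (simp add: card_Un_disjoint)
    also have "\<dots> \<le> card {..<m - 1}"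
      by (rule card_mono) (auto simp: A_def B_def)
    finally show False using cA cB len m unfolding m_def card_lessThan by linarith
  qed
  then obtain i where i: "Suc i < m" "E (hd p) (p ! Suc i)" "E (last p) (p ! i)"
    by (auto simp: A_def B_def)
  define xs ys where "xs = take (Suc i) p" and "ys = drop (Suc i) p"
  have ne: "xs \<noteq> []" "ys \<noteq> []" and pxy: "p = xs @ ys"
    using i by (auto simp: xs_def ys_def m_def)
  have "last xs = p ! i" "hd ys = p ! Suc i"
    using i by (auto simp: xs_def ys_def m_def take_Suc_conv_app_nth hd_drop_conv_nth)
  then have E: "E (hd xs) (hd ys)" "E (last ys) (last xs)"
    using i ne pxy by auto
  have "successively E xs" and ys: "successively E ys"
    using p(3) unfolding pxy by (simp_all add: successively_append_iff)
  moreover have "successively E (rev ys)"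
    using ys sym unfolding successively_rev by (metis (mono_tags, lifting) successively_mono)
  \<comment> \<open>One chord joins \<open>last xs\<close> to \<open>last ys\<close>; the other,
    from \<open>hd ys\<close> to \<open>hd xs\<close>, closes the cycle.\<close>
  ultimately have "successively E (xs @ rev ys)"
    using sym[OF E(2)] ne by (simp add: successively_append_iff hd_rev)
  then show thesis
    using that[of "xs @ rev ys"] ne sym[OF E(1)] p pxy by (auto simp: last_rev)
qed

text \<open>The relation \<open>E\<close> stays fixed and only \<open>V\<close> shrinks, so the path
  bound is inherited by subsets and only the degree condition has to be checked again. The bound
  \<open>d \<ge> 2\<close> gives \<open>d + 2 \<le> 2 * d\<close> for the crossing argument.\<close>

lemma card_decomposition_of_no_long_path:
  fixes d :: nat
  assumes sym: "\<And>x y. E x y \<Longrightarrow> E y x" and irr: "\<And>x. \<not> E x x" and d: "d \<ge> 2"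
    and "finite V" and "\<And>v. v \<in> V \<Longrightarrow> card {w \<in> V. E v w} \<ge> d"
    and "\<And>p. distinct p \<Longrightarrow> set p \<subseteq> V \<Longrightarrow> successively E p \<Longrightarrow> length p \<le> d + 2"
  shows "\<exists>a b. card V = a * (d + 2) + b * (d + 1)"
  using assms(4-6)
proof (induction V rule: finite_psubset_induct)
  case (psubset V)
  show ?case
  proof (cases "V = {}")
    case True
    then show ?thesis by (intro exI[of _ 0]) simp
  next
    case False
    define P where "P p \<longleftrightarrow> distinct p \<and> set p \<subseteq> V \<and> successively E p" for p
    obtain v where "v \<in> V" using False by blast
    then have "P [v]" by (simp add: P_def)
    moreover have bound: "\<forall>p. P p \<longrightarrow> length p < Suc (d + 2)"
      using psubset.prems(2) by (auto simp: P_def less_Suc_eq_le)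
    ultimately obtain p where p: "P p" and max: "\<And>q. P q \<Longrightarrow> length q \<le> length p"
      using ex_has_greatest_nat[of P "[v]" length "Suc (d + 2)"] by blast
    have ne: "p \<noteq> []" using max[OF \<open>P [v]\<close>] by auto
    have hd_nb: "w \<in> set p" if "w \<in> V" "E (hd p) w" for w
    proof (rule ccontr)
      assume "w \<notin> set p"
      then have "P (w # p)" using that p sym[OF that(2)] ne by (auto simp: P_def successively_Cons)
      then show False using max[of "w # p"] by simp
    qed
    have last_nb: "w \<in> set p" if "w \<in> V" "E (last p) w" for w
    proof (rule ccontr)
      assume "w \<notin> set p"
      then have "P (p @ [w])" using that p ne by (auto simp: P_def successively_append_iff)
      then show False using max[of "p @ [w]"] by simp
    qed
    have sub: "set p \<subseteq> V" using p by (simp add: P_def)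
    have "{w \<in> V. E (hd p) w} = {w \<in> set p. E (hd p) w}"
      "{w \<in> V. E (last p) w} = {w \<in> set p. E (last p) w}"
      using hd_nb last_nb sub by auto
    then have deg: "card {w \<in> set p. E (hd p) w} \<ge> d" "card {w \<in> set p. E (last p) w} \<ge> d"
      using psubset.prems(1) ne sub by (metis hd_in_set last_in_set subsetD)+
    have cardp: "card (set p) = length p"
      using p by (simp add: P_def distinct_card)
    \<comment> \<open>The path holds the head besides its \<open>d\<close> or more
      neighbours.\<close>
    have "{w \<in> set p. E (hd p) w} \<subset> set p"
      using irr hd_in_set[OF ne] by blast
    then have "card {w \<in> set p. E (hd p) w} < card (set p)"
      by (simp add: psubset_card_mono)
    then have lower: "d + 1 \<le> length p"
      using deg(1) cardp by simp
    have upper: "length p \<le> d + 2" using bound p by (simp add: less_Suc_eq_le)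
    obtain c where c: "c \<noteq> []" "distinct c" "set c = set p" "successively E c" "E (last c) (hd c)"
    proof (rule spanning_cycle_of_path[of E p d])
      show "E y x" if "E x y" for x y using that by (rule sym)
      show "\<not> E x x" for x by (rule irr)
      show "length p \<le> 2 * d" using upper d by simp
      show "distinct p" "successively E p" using p by (simp_all add: P_def)
    qed (assumption | rule ne deg that)+
    \<comment> \<open>Rotating the cycle to start at \<open>u\<close> and putting \<open>w\<close>
      in front would give a path longer than \<open>p\<close>.\<close>
    have closed: "w \<in> set p" if u: "u \<in> set p" and w_in: "w \<in> V" and uw: "E u w" for u w
    proof (rule ccontr)
      assume w: "w \<notin> set p"
      obtain xs ys where xy: "c = xs @ u # ys"
        using u c(3) by (metis split_list)
      have "successively E xs" "successively E (u # ys)"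
        using c(4) unfolding xy by (simp_all only: successively_append_iff)
      \<comment> \<open>This is the closing edge of the cycle; for empty \<open>xs\<close> the cycle
        already starts at \<open>u\<close>.\<close>
      moreover have "E (last (u # ys)) (hd xs)" if "xs \<noteq> []"
        using c(5) that unfolding xy by simp
      ultimately have "successively E ((u # ys) @ xs)"
        by (simp only: successively_append_iff) blast
      then have "successively E (w # u # ys @ xs)"
        using sym[OF uw] by simp
      moreover have "distinct (w # u # ys @ xs)" "set (w # u # ys @ xs) \<subseteq> V"
        using c(2,3) w w_in sub xy by auto
      ultimately have "P (w # u # ys @ xs)" by (simp add: P_def)
      then have "length (w # u # ys @ xs) \<le> length p" by (rule max)
      moreover have "length c = length p"
        using c(2,3) cardp by (metis distinct_card)
      ultimately show False using xy by simp
    qed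
    let ?W = "V - set p"
    have "?W \<subset> V" using hd_in_set[OF ne] sub by blast
    moreover have "card {w \<in> ?W. E v w} \<ge> d" if "v \<in> ?W" for v
    proof -
      have "{w \<in> ?W. E v w} = {w \<in> V. E v w}"
        using closed sym that by blast
      then show ?thesis using psubset.prems(1) that by simp
    qed
    moreover have "length q \<le> d + 2" if "distinct q" "set q \<subseteq> ?W" "successively E q" for q
      using psubset.prems(2) that by blast
    ultimately obtain a b where ab: "card ?W = a * (d + 2) + b * (d + 1)"
      using psubset.IH by meson
    have cardV: "card V = card ?W + length p"
      using cardp sub psubset.hyps
      by (metis card_Diff_subset card_mono finite_set le_add_diff_inverse2)
    consider "length p = d + 1" | "length p = d + 2"
      using lower upper by linarith
    then show ?thesis
    proof cases
      case 1
      then have "card V = a * (d + 2) + Suc b * (d + 1)"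
        using ab cardV by simp
      then show ?thesis by blast
    next
      case 2
      then have "card V = Suc a * (d + 2) + b * (d + 1)"
        using ab cardV by simp
      then show ?thesis by blast
    qed
  qed
qed

section \<open>Stars, paths and complementary degrees\<close>

lemma contains_star:
  assumes G: "simple_graph G" and v: "v \<in> fst G" and deg: "card {w \<in> fst G. {v, w} \<in> snd G} \<ge> n - 1"
  shows "contains_copy G (star_graph n)"
proof -
  let ?D = "{w \<in> fst G. {v, w} \<in> snd G}"
  have fin: "finite ?D" using G by (simp add: simple_graph_def)
  have v_notin: "v \<notin> ?D" using G by (auto simp: simple_graph_def nsets_def)
  have "card {0<..<n} \<le> card ?D" using deg by simp
  then obtain g where g: "g ` {0<..<n} \<subseteq> ?D" "inj_on g {0<..<n}"
    using card_le_inj[OF _ fin] by blast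
  define f where "f = g(0 := v)"
  have g_in: "g i \<in> ?D" if "0 < i" "i < n" for i
    using g(1) that by (auto simp: image_subset_iff)
  \<comment> \<open>Only an inclusion, since equality fails for \<open>n = 0\<close>.\<close>
  have ins: "{..<n} \<subseteq> insert 0 {0<..<n}" by auto
  have "inj_on f {0<..<n}"
    using g(2) by (simp add: f_def inj_on_def)
  moreover have "v \<notin> g ` {0<..<n}" using g(1) v_notin by blast
  then have "f 0 \<notin> f ` ({0<..<n} - {0})" by (simp add: f_def)
  ultimately have "inj_on f (insert 0 {0<..<n})"
    unfolding inj_on_insert by blast
  then have "inj_on f {..<n}" using ins by (rule inj_on_subset)
  moreover have "f ` {..<n} \<subseteq> fst G"
  proof (intro image_subsetI)
    show "f i \<in> fst G" if "i \<in> {..<n}" for i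
      using g_in[of i] that v by (cases "i = 0") (simp_all add: f_def)
  qed
  moreover have "f ` e \<in> snd G" if e: "e \<in> {{0, i} | i. 0 < i \<and> i < n}" for e
  proof -
    obtain i where "e = {0, i}" "0 < i" "i < n" using e by blast
    then show ?thesis using g_in[of i] by (simp add: f_def insert_commute)
  qed
  ultimately show ?thesis
    unfolding contains_copy_def star_graph_def fst_conv snd_conv by blast
qed

lemma contains_path:
  assumes p: "distinct p" "set p \<subseteq> fst G" "successively (\<lambda>x y. {x, y} \<in> snd G) p"
    and k: "k \<le> length p"
  shows "contains_copy G (path_graph k)"
  unfolding contains_copy_def path_graph_def
proof (intro exI[of _ "\<lambda>i. p ! i"] conjI)
  show "inj_on ((!) p) (fst ({..<k}, {{i, Suc i} |i. Suc i < k}))"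
    using p(1) k by (auto simp: inj_on_def nth_eq_iff_index_eq)
  show "(!) p ` fst ({..<k}, {{i, Suc i} |i. Suc i < k}) \<subseteq> fst G"
    using p(2) k by (auto intro!: subsetD[OF p(2)])
  show "\<forall>e\<in>snd ({..<k}, {{i, Suc i} |i. Suc i < k}). (!) p ` e \<in> snd G"
    using p(3) k by (auto simp: successively_conv_nth)
qed

text \<open>Every vertex other than \<open>v\<close> is a neighbour of \<open>v\<close> in exactly
  one of the two graphs; the summand 1 counts \<open>v\<close> itself.\<close>

lemma card_complement_neighbours:
  assumes G: "simple_graph G" and v: "v \<in> fst G"
  shows "card {w \<in> fst G. {v, w} \<in> snd (complement G)} + card {w \<in> fst G. {v, w} \<in> snd G} + 1
         = card (fst G)"
proof -
  let ?C = "{w \<in> fst G. {v, w} \<in> snd (complement G)}" and ?D = "{w \<in> fst G. {v, w} \<in> snd G}"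
  have fin: "finite (fst G)" using G by (simp add: simple_graph_def)
  have "{v, v} \<notin> snd G" using G by (auto simp: simple_graph_def nsets_def)
  then have "fst G = insert v (?C \<union> ?D)" "v \<notin> ?C \<union> ?D"
    using v by (auto simp: complement_def)
  then have "card (fst G) = card (?C \<union> ?D) + 1"
    using fin by (metis (no_types, lifting) Suc_eq_plus1 card_insert_disjoint finite_insert)
  also have "card (?C \<union> ?D) = card ?C + card ?D"
    using fin by (intro card_Un_disjoint) (auto simp: complement_def)
  finally show ?thesis by simp
qed

lemma ramsey_prop_star_path:
  fixes k n :: nat
  assumes k: "k \<ge> 5" and n: "n \<ge> 1"
    and no: "\<not> (\<exists>a b :: nat. a * (k - 1) + b * (k - 2) = n + k - 4)"
  shows "ramsey_prop (star_graph n) (path_graph k) (n + k - 4)"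
  unfolding ramsey_prop_def
proof (intro allI impI, rule ccontr)
  fix G :: "nat graph"
  assume G: "simple_graph G \<and> card (fst G) = n + k - 4"
    and neg: "\<not> (contains_copy G (star_graph n) \<or> contains_copy (complement G) (path_graph k))"
  define E where "E x y \<longleftrightarrow> {x, y} \<in> snd (complement G)" for x y
  \<comment> \<open>Here \<open>d = k - 3\<close>: a path in the complement has at most
    \<open>k - 1 = d + 2\<close> vertices.\<close>
  have "\<exists>a b. card (fst G) = a * (k - 3 + 2) + b * (k - 3 + 1)"
  proof (rule card_decomposition_of_no_long_path[where E = E])
    show "E y x" if "E x y" for x y
      using that by (simp add: E_def insert_commute)
    show "\<not> E x x" for x
      by (auto simp: E_def complement_def nsets_def)
    show "2 \<le> k - 3" using k by simp
    show "finite (fst G)" using G by (simp add: simple_graph_def)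
    show "k - 3 \<le> card {w \<in> fst G. E v w}" if v: "v \<in> fst G" for v
    proof -
      \<comment> \<open>Degree at most \<open>n - 2\<close> leaves at least
        \<open>(n + k - 4) - 1 - (n - 2) = k - 3\<close> neighbours in the complement.\<close>
      have "card {w \<in> fst G. {v, w} \<in> snd G} < n - 1"
        using contains_star[OF _ v] G neg not_le by blast
      then show ?thesis
        using card_complement_neighbours[OF _ v] G k n by (simp add: E_def)
    qed
    show "length p \<le> k - 3 + 2" if "distinct p" "set p \<subseteq> fst G" "successively E p" for p
    proof (rule ccontr)
      assume "\<not> length p \<le> k - 3 + 2"
      then have "contains_copy (complement G) (path_graph k)"
        using contains_path[of p "complement G" k] that k
        by (simp add: E_def[abs_def] complement_def)
      then show False using neg by simp
    qed
  qed
  moreover have "k - 3 + 2 = k - 1" "k - 3 + 1 = k - 2" using k by simp_all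
  ultimately show False using no G by metis
qed

section \<open>The Frobenius number of consecutive integers\<close>

text \<open>For \<open>m \<ge> 2\<close> the Frobenius number of \<open>m\<close> and
  \<open>m + 1\<close> is \<open>m * m - m - 1\<close>; the subtracted terms are moved to the left
  to stay within the naturals. Modulo \<open>m\<close> an equality would force \<open>m\<close> to
  divide \<open>a + 1\<close>, so \<open>a + 1 \<ge> m\<close>, and the left side would exceed
  \<open>m * m\<close>.\<close>

lemma frobenius_number_consecutive:
  fixes a b m :: nat
  shows "a * (m + 1) + b * m + m + 1 \<noteq> m * m"
proof
  assume eq: "a * (m + 1) + b * m + m + 1 = m * m"
  then have "a + 1 + m * (a + b + 1) = m * m" by (simp add: algebra_simps)
  then have "m dvd a + 1" by (metis dvd_add_left_iff dvd_triv_left)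
  then have "m \<le> a + 1" by (simp add: dvd_imp_le)
  then have "m * m \<le> (a + 1) * m" by (rule mult_le_mono1)
  then show False using eq by (simp add: algebra_simps)
qed

theorem proposition1p1:
  fixes k n N :: nat
  assumes "k \<ge> 5" and "n \<ge> 1" and "N = n + k - 4"
  shows "(\<not> (\<exists>a b :: nat. a * (k - 1) + b * (k - 2) = N)
          \<longrightarrow> ramsey_number (star_graph n) (path_graph k) \<le> N)
       \<and> (n = (k - 3)\<^sup>2
            \<longrightarrow> \<not> (\<exists>a b :: nat. a * (k - 1) + b * (k - 2) = N)
                \<and> ramsey_number (star_graph n) (path_graph k) \<le> N)"
proof -
  have bound: "ramsey_number (star_graph n) (path_graph k) \<le> N"
    if "\<not> (\<exists>a b :: nat. a * (k - 1) + b * (k - 2) = N)"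
    unfolding ramsey_number_def
    \<comment> \<open>The minimum ranges over positive numbers; here
      \<open>N \<ge> 2\<close>.\<close>
    using ramsey_prop_star_path that assms by (intro Least_le) auto
  have "\<not> (\<exists>a b :: nat. a * (k - 1) + b * (k - 2) = N)" if n: "n = (k - 3)\<^sup>2"
  proof (intro notI, elim exE)
    fix a b assume eq: "a * (k - 1) + b * (k - 2) = N"
    obtain j where k: "k = j + 3"
      using assms(1) by (intro that[of "k - 3"]) simp
    \<comment> \<open>With \<open>m = j + 1 = k - 2\<close> this reads
      \<open>N = m * m - m - 1\<close>.\<close>
    have "N + (j + 1) + 1 = (j + 1) * (j + 1)"
      using n assms(1,3) k by (simp add: power2_eq_square)
    then show False
      using frobenius_number_consecutive[of a "j + 1" b] eq k by simp
  qed
  then show ?thesis using bound by blast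
qed

end
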